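(* Let $T$ be a tree with at least two vertices. Then $T$ is $k$-metric antidimensional for some $k\ge\max\{\phi(T),\xi(T)\}$.
   Context: Graphs are finite and simple; $d_G(u,v)$ is the length of a shortest path between $u$ and $v$. For an ordered set $S=\{u_1,\dots,u_t\}\subseteq V(G)$ ($t\ge1$) and $v\in V(G)$, let $r(v|S)=(d_G(v,u_1),\dots,d_G(v,u_t))$. A nonempty proper subset $S\subset V(G)$ is a $k$-antiresolving set if $k$ is the greatest positive integer such that for every $v\in V(G)-S$ there exist at least $k-1$ different vertices $v_1,\dots,v_{k-1}\in V(G)-S$, all different from $v$, with $r(v|S)=r(v_1|S)=\cdots=r(v_{k-1}|S)$. A connected graph $G$ is $k$-metric antidimensional if $k$ is the largest integer such that $G$ contains a $k$-antiresolving set. The eccentricity $\epsilon(u)$ of a vertex $u$ is the maximum of $d_G(u,v)$ over $v\in V(G)$. For $i\in\{1,\dots,\epsilon(u)\}$ let $d_i(u)=\{v\in V(G): d_G(v,u)=i\}$. Put $\phi(u)=\min_{1\le i\le\epsilon(u)}|d_i(u)|$ and $\phi(G)=\max_{v\in V(G)}\phi(v)$. Let $T$ be a tree, $u$ a vertex of degree at least two and $v$ a neighbor of $u$. The $v$-branch $T_{u,v}$ at $u$ is the subtree obtained from the union of all length-maximal paths beginning in $u$, passing through $v$ and finishing at a vertex of degree one in $T$ (i.e. the subtree induced by $u$ and the component of $T-u$ containing $v$). $\xi(T_{u,v})$ is the eccentricity of the vertex $u$ in $T_{u,v}$. Two branches $T_{x,y_1},T_{x,y_2}$ at $x$ (with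 $y_1\neq y_2$) are $\xi_x$-equivalent if $\xi(T_{x,y_1})=\xi(T_{x,y_2})$. For a vertex $x$ of degree at least two, $\xi(x)$ is the maximum number of pairwise $\xi_x$-equivalent branches at $x$, with $\xi(x)=0$ if no two distinct branches at $x$ are $\xi_x$-equivalent. Finally $\xi(T)=\max\{\xi(x): x\in V(T),\ \deg(x)\ge2\}$ (taken to be $0$ if there is no vertex of degree at least two). *)

theory Defs
  imports "Graph_Theory.Graph_Theory"
begin

text \<open>
  A finite simple graph is a structure satisfying the locale \<^locale>\<open>graph\<close>, i.e. a finite
  symmetric digraph without loops and parallel arcs; every undirected edge is a pair of opposite
  arcs, so the out-degree of a vertex is its degree. Consequently a back-and-forth walk along one
  edge is a \<^const>\<open>pre_digraph.cycle\<close> of length 2, and the library's \<^const>\<open>forest\<close> and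
  \<^const>\<open>tree\<close> cannot be used for undirected trees: only cycles of length at least 3 count.
\<close>

definition undirected_tree :: "('a,'b) pre_digraph \<Rightarrow> bool" where
  "undirected_tree G \<longleftrightarrow> graph G \<and> Digraph_Component.connected G \<and>
     \<not> (\<exists>c. pre_digraph.cycle G c \<and> 3 \<le> length c)"

definition gdist :: "('a,'b) pre_digraph \<Rightarrow> 'a \<Rightarrow> 'a \<Rightarrow> nat" where
  "gdist G u v = (LEAST n. \<exists>p. pre_digraph.apath G u p v \<and> length p = n)"

text \<open>Ordered vertex sets are represented by distinct lists.\<close>

definition metric_rep :: "('a,'b) pre_digraph \<Rightarrow> 'a list \<Rightarrow> 'a \<Rightarrow> nat list" where
  "metric_rep G us v = map (gdist G v) us"

definition antiresolving_cond :: "('a,'b) pre_digraph \<Rightarrow> 'a list \<Rightarrow> nat \<Rightarrow> bool" where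
  "antiresolving_cond G us k \<longleftrightarrow>
     (\<forall>v \<in> verts G - set us. \<exists>W \<subseteq> verts G - set us - {v}.
        k - 1 \<le> card W \<and> (\<forall>w\<in>W. metric_rep G us w = metric_rep G us v))"

definition k_antiresolving :: "('a,'b) pre_digraph \<Rightarrow> nat \<Rightarrow> 'a list \<Rightarrow> bool" where
  "k_antiresolving G k us \<longleftrightarrow>
     distinct us \<and> us \<noteq> [] \<and> set us \<subset> verts G \<and>
     0 < k \<and> antiresolving_cond G us k \<and>
     (\<forall>j>0. antiresolving_cond G us j \<longrightarrow> j \<le> k)"

definition k_metric_antidimensional :: "('a,'b) pre_digraph \<Rightarrow> nat \<Rightarrow> bool" where
  "k_metric_antidimensional G k \<longleftrightarrow>
     graph G \<and> Digraph_Component.connected G \<and>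
     (\<exists>us. k_antiresolving G k us) \<and>
     (\<forall>j. (\<exists>us. k_antiresolving G j us) \<longrightarrow> j \<le> k)"

definition eccentricity :: "('a,'b) pre_digraph \<Rightarrow> 'a \<Rightarrow> nat" where
  "eccentricity G u = Max (gdist G u ` verts G)"

definition dist_layer :: "('a,'b) pre_digraph \<Rightarrow> nat \<Rightarrow> 'a \<Rightarrow> 'a set" where
  "dist_layer G i u = {v \<in> verts G. gdist G v u = i}"

definition phi_vertex :: "('a,'b) pre_digraph \<Rightarrow> 'a \<Rightarrow> nat" where
  "phi_vertex G u = Min ((\<lambda>i. card (dist_layer G i u)) ` {1..eccentricity G u})"

definition phi :: "('a,'b) pre_digraph \<Rightarrow> nat" where
  "phi G = Max (phi_vertex G ` verts G)"

text \<open>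
  The branch at \<open>u\<close> towards its neighbour \<open>v\<close>: the subgraph induced by \<open>u\<close> together with the
  component of \<open>v\<close> after deleting \<open>u\<close>.
\<close>

definition branch :: "('a,'b) pre_digraph \<Rightarrow> 'a \<Rightarrow> 'a \<Rightarrow> ('a,'b) pre_digraph" where
  "branch G u v = G \<restriction> insert u {w. v \<rightarrow>\<^sup>*\<^bsub>pre_digraph.del_vert G u\<^esub> w}"

definition branch_ecc :: "('a,'b) pre_digraph \<Rightarrow> 'a \<Rightarrow> 'a \<Rightarrow> nat" where
  "branch_ecc G u v = eccentricity (branch G u v) u"

text \<open>Branches at \<open>x\<close> are indexed by the neighbours of \<open>x\<close>.\<close>

definition neighbours :: "('a,'b) pre_digraph \<Rightarrow> 'a \<Rightarrow> 'a set" where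
  "neighbours G x = {y. x \<rightarrow>\<^bsub>G\<^esub> y}"

definition xi_equiv :: "('a,'b) pre_digraph \<Rightarrow> 'a \<Rightarrow> 'a \<Rightarrow> 'a \<Rightarrow> bool" where
  "xi_equiv G x y1 y2 \<longleftrightarrow> y1 \<noteq> y2 \<and> branch_ecc G x y1 = branch_ecc G x y2"

definition xi_vertex :: "('a,'b) pre_digraph \<Rightarrow> 'a \<Rightarrow> nat" where
  "xi_vertex G x =
     (if \<exists>y1 \<in> neighbours G x. \<exists>y2 \<in> neighbours G x. xi_equiv G x y1 y2
      then Max {card Y | Y. Y \<subseteq> neighbours G x \<and> pairwise (xi_equiv G x) Y}
      else 0)"

definition xi :: "('a,'b) pre_digraph \<Rightarrow> nat" where
  "xi G = (if \<exists>x \<in> verts G. 2 \<le> out_degree G x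
           then Max {xi_vertex G x | x. x \<in> verts G \<and> 2 \<le> out_degree G x}
           else 0)"

end

theory Submission
  imports Defs
begin

text \<open>
  If some nonempty proper vertex set satisfies the antiresolving condition for \<open>k\<close>, then \<open>k\<close> is a
  lower bound for the metric antidimension. A singleton \<open>{u}\<close> does so for \<open>k = \<phi>(u)\<close>, because its
  classes are the distance layers of \<open>u\<close>. Given a set \<open>Y\<close> of neighbours of \<open>x\<close> whose branches have
  equal depth, delete all these branches except for \<open>x\<close> itself and let \<open>S\<close> be the set of the remaining
  vertices. Each walk from a deleted vertex to \<open>S\<close> passes through \<open>x\<close>, so the class of a deleted vertex is
  determined by its distance to \<open>x\<close> and meets each of the branches, which are disjoint since the
  graph is acyclic.
\<close>

section \<open>Walks, powers of the adjacency relation and distances\<close>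

lemma relpow_mono_rel: "r \<subseteq> (s :: ('a \<times> 'a) set) \<Longrightarrow> r ^^ n \<subseteq> s ^^ n"
proof (induction n)
  case (Suc n)
  then show ?case by (simp add: relcomp_mono)
qed simp

text \<open>Walks are traded for relation powers, where concatenation, reversal and passage from a
  subgraph are plain relation algebra.\<close>

lemma (in wf_digraph) awalk_length_iff_relpow:
  assumes "u \<in> verts G"
  shows "(\<exists>p. awalk u p v \<and> length p = n) \<longleftrightarrow> (u, v) \<in> arcs_ends G ^^ n"
  using assms
proof (induction n arbitrary: u)
  case 0
  then show ?case by (auto simp: awalk_Nil_iff)
next
  case (Suc n)
  show ?case
  proof
    assume "\<exists>p. awalk u p v \<and> length p = Suc n"
    then obtain e q where q: "awalk u (e # q) v" "length q = n"
      by (auto simp: length_Suc_conv)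
    then have e: "e \<in> arcs G" "tail G e = u" "awalk (head G e) q v"
      by (auto simp: awalk_Cons_iff)
    then have "(head G e, v) \<in> arcs_ends G ^^ n"
      using q(2) by (intro iffD1[OF Suc.IH] exI[of _ q]) simp_all
    moreover have "(u, head G e) \<in> arcs_ends G"
      using e by (auto simp: arcs_ends_conv)
    ultimately show "(u, v) \<in> arcs_ends G ^^ Suc n"
      by (rule relpow_Suc_I2[rotated])
  next
    assume "(u, v) \<in> arcs_ends G ^^ Suc n"
    then obtain w where w: "(u, w) \<in> arcs_ends G" "(w, v) \<in> arcs_ends G ^^ n"
      by (rule relpow_Suc_E2) auto
    then obtain q where q: "awalk w q v" "length q = n"
      using iffD2[OF Suc.IH[OF adj_in_verts(2)[OF w(1)]] w(2)] by blast
    from w(1) obtain e where "e \<in> arcs G" "tail G e = u" "head G e = w" by auto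
    then have "awalk u (e # q) v" using q by (auto simp: awalk_Cons_iff)
    then show "\<exists>p. awalk u p v \<and> length p = Suc n" using q(2) by (intro exI[of _ "e # q"]) simp
  qed
qed

text \<open>\<open>gdist\<close> minimises over paths, so walks have to be shortened. The extracted
  path uses only arcs of the walk, and distinctness makes its length the size of its arc
  set.\<close>

lemma (in wf_digraph) awalk_imp_apath_le:
  assumes "awalk u p v"
  obtains q where "apath u q v" "length q \<le> length p"
proof
  show ap: "apath u (awalk_to_apath p) v" using assms by (rule apath_awalk_to_apath)
  then have "distinct (awalk_to_apath p)"
    by (auto simp: apath_def intro: distinct_verts_imp_distinct)
  then have "length (awalk_to_apath p) = card (set (awalk_to_apath p))"
    by (simp add: distinct_card)
  also have "\<dots> \<le> card (set p)"
    using awalk_to_apath_subset[OF assms] by (simp add: card_mono)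
  also have "\<dots> \<le> length p" by (rule card_length)
  finally show "length (awalk_to_apath p) \<le> length p" .
qed

lemma (in wf_digraph) gdist_le:
  assumes "u \<in> verts G" "(u, v) \<in> arcs_ends G ^^ n"
  shows "gdist G u v \<le> n"
proof -
  obtain p where "awalk u p v" "length p = n"
    using assms awalk_length_iff_relpow by blast
  then obtain q where q: "apath u q v" "length q \<le> n"
    using awalk_imp_apath_le by metis
  have "gdist G u v \<le> length q"
    unfolding gdist_def using q(1) by (intro Least_le) auto
  with q(2) show ?thesis by simp
qed

text \<open>The given walk only ensures that some path exists, so that the \<open>LEAST\<close> in
  \<open>gdist\<close> is attained.\<close>

lemma (in wf_digraph) gdist_relpow:
  assumes "u \<in> verts G" "(u, v) \<in> arcs_ends G ^^ n"
  shows "(u, v) \<in> arcs_ends G ^^ gdist G u v"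
proof -
  obtain p where "awalk u p v" using assms awalk_length_iff_relpow by blast
  then obtain q where "apath u q v" using awalk_imp_apath_le by metis
  then have "\<exists>n p. apath u p v \<and> length p = n" by auto
  then have "\<exists>p. apath u p v \<and> length p = gdist G u v"
    unfolding gdist_def by (rule LeastI_ex)
  then show ?thesis
    using awalk_length_iff_relpow[OF assms(1)] by (auto simp: apath_def)
qed

lemma (in wf_digraph) gdist_eqI:
  assumes "u \<in> verts G" "(u, v) \<in> arcs_ends G ^^ n"
    and "\<And>m. (u, v) \<in> arcs_ends G ^^ m \<Longrightarrow> n \<le> m"
  shows "gdist G u v = n"
  using gdist_le[OF assms(1,2)] assms(3)[OF gdist_relpow[OF assms(1,2)]] by (rule le_antisym)

text \<open>This is the vertex set in \<open>branch\<close> without \<open>x\<close>: all branches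
  at \<open>x\<close> share \<open>x\<close>, but these parts can be disjoint.\<close>

definition comp_away :: "('a,'b) pre_digraph \<Rightarrow> 'a \<Rightarrow> 'a \<Rightarrow> 'a set" where
  "comp_away G x y = {w. y \<rightarrow>\<^sup>*\<^bsub>pre_digraph.del_vert G x\<^esub> w}"

lemma arcs_ends_del_vert:
  "(a, b) \<in> arcs_ends (pre_digraph.del_vert G x) \<longleftrightarrow> (a, b) \<in> arcs_ends G \<and> a \<noteq> x \<and> b \<noteq> x"
  by (auto simp: arcs_ends_conv pre_digraph.del_vert_simps)

lemma arcs_ends_induce_subgraph:
  "(a, b) \<in> arcs_ends (G \<restriction> S) \<longleftrightarrow> (a, b) \<in> arcs_ends G \<and> a \<in> S \<and> b \<in> S"
  by (auto simp: arcs_ends_conv)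

section \<open>Distances in connected graphs\<close>

locale connected_graph = graph +
  assumes conn: "Digraph_Component.connected G"
begin

lemma verts_reachable: "u \<in> verts G \<Longrightarrow> v \<in> verts G \<Longrightarrow> u \<rightarrow>\<^sup>* v"
  using symmetric_connected_imp_strongly_connected[OF sym_arcs conn]
  by (auto simp: strongly_connected_def)

lemma gdist_walk:
  assumes "u \<in> verts G" "v \<in> verts G"
  shows "(u, v) \<in> arcs_ends G ^^ gdist G u v"
proof -
  have "(u, v) \<in> (arcs_ends G)\<^sup>*"
    using verts_reachable[OF assms] by (rule reachable_rtranclI)
  then obtain n where "(u, v) \<in> arcs_ends G ^^ n" using rtrancl_imp_relpow by metis
  with assms(1) show ?thesis by (rule gdist_relpow)
qed

lemma relpow_sym: "(u, v) \<in> arcs_ends G ^^ n \<Longrightarrow> (v, u) \<in> arcs_ends G ^^ n"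
proof (induction n arbitrary: v)
  case (Suc n)
  then show ?case by (metis graph_symmetric relpow_Suc_E relpow_Suc_I2)
qed simp

lemma gdist_commute:
  assumes "u \<in> verts G" "v \<in> verts G"
  shows "gdist G u v = gdist G v u"
  using gdist_le[OF assms(1) relpow_sym[OF gdist_walk[OF assms(2,1)]]]
    gdist_le[OF assms(2) relpow_sym[OF gdist_walk[OF assms]]] by (rule le_antisym)

lemma gdist_pos:
  assumes "u \<in> verts G" "v \<in> verts G" "u \<noteq> v"
  shows "0 < gdist G u v"
  using gdist_walk[OF assms(1,2)] assms(3) by (cases "gdist G u v") auto

lemma gdist_le_eccentricity: "v \<in> verts G \<Longrightarrow> gdist G u v \<le> eccentricity G u"
  unfolding eccentricity_def by (intro Max_ge) auto

text \<open>The last vertex but one of a shortest walk serves as \<open>z\<close>: a shorter way to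
  it would extend to a shorter way to \<open>w\<close>.\<close>

lemma gdist_Suc_pred:
  assumes "x \<in> verts G" "w \<in> verts G" "gdist G x w = Suc n"
  obtains z where "(x, z) \<in> arcs_ends G ^^ n" "(z, w) \<in> arcs_ends G" "gdist G x z = n"
proof -
  obtain z where z: "(x, z) \<in> arcs_ends G ^^ n" "(z, w) \<in> arcs_ends G"
    using gdist_walk[OF assms(1,2)] assms(3) by (metis relpow_Suc_E)
  have "gdist G x z = n"
  proof (rule gdist_eqI[OF assms(1) z(1)])
    fix m assume "(x, z) \<in> arcs_ends G ^^ m"
    then have "(x, w) \<in> arcs_ends G ^^ Suc m" using z(2) by auto
    then show "n \<le> m" using gdist_le[OF assms(1)] assms(3) by fastforce
  qed
  with z show thesis by (rule that)
qed

section \<open>Branches and their depth\<close>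

context
  fixes x y
  assumes xy: "(x, y) \<in> arcs_ends G"
begin

lemma edge_verts: "x \<in> verts G" "y \<in> verts G" "x \<noteq> y"
  using xy adj_in_verts adj_not_same by auto

lemma comp_away_subset: "comp_away G x y \<subseteq> verts G - {x}"
  unfolding comp_away_def
  by (auto elim!: reachable_in_vertsE simp: del_vert_simps)

lemma comp_away_self: "y \<in> comp_away G x y"
  unfolding comp_away_def using edge_verts
  by (auto simp: del_vert_simps intro!: wf_digraph.reachable_refl wf_digraph_del_vert)

lemma comp_away_step:
  assumes "w \<in> comp_away G x y" "(w, z) \<in> arcs_ends G" "z \<noteq> x"
  shows "z \<in> comp_away G x y"
proof -
  have "w \<noteq> x" using assms(1) comp_away_subset by auto
  then have "(w, z) \<in> arcs_ends (del_vert x)"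
    using assms by (simp add: arcs_ends_del_vert)
  then show ?thesis using assms(1) unfolding comp_away_def
    by (auto intro: wf_digraph.reachable_adj_trans wf_digraph_del_vert)
qed

text \<open>One step back towards \<open>x\<close> either reaches \<open>x\<close> or stays in the
  component, which is closed under steps avoiding \<open>x\<close>. Inductions on the distance from
  \<open>x\<close> rest on this.\<close>

lemma comp_away_pred:
  assumes "w \<in> comp_away G x y" "gdist G x w = Suc n"
  obtains "n = 0" "(x, w) \<in> arcs_ends G"
  | z where "z \<in> comp_away G x y" "(z, w) \<in> arcs_ends G" "gdist G x z = n" "0 < n"
proof -
  have w: "w \<in> verts G" using assms(1) comp_away_subset by auto
  obtain z where z: "(x, z) \<in> arcs_ends G ^^ n" "(z, w) \<in> arcs_ends G" "gdist G x z = n"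
    using gdist_Suc_pred[OF edge_verts(1) w assms(2)] .
  show thesis
  proof (cases "z = x")
    case True
    have "gdist G x x = 0" using gdist_le[OF edge_verts(1), of x 0] by simp
    with True z that(1) show ?thesis by simp
  next
    case False
    then have "0 < n" using z adj_in_verts(1)[OF z(2)] gdist_pos edge_verts(1) by metis
    moreover have "z \<in> comp_away G x y"
      using comp_away_step[OF assms(1) graph_symmetric[OF z(2)] False] .
    ultimately show ?thesis using that(2) z by blast
  qed
qed

text \<open>Each step back towards \<open>x\<close> lowers the distance by exactly one, so no value
  is skipped on the way down to \<open>1\<close>.\<close>

lemma comp_away_dist_downward:
  assumes "w \<in> comp_away G x y" "0 < d" "d \<le> gdist G x w"
  shows "\<exists>c \<in> comp_away G x y. gdist G x c = d"
  using assms
proof (induction "gdist G x w" arbitrary: w)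
  case (Suc n)
  show ?case
  proof (cases "d = Suc n")
    case True
    then show ?thesis using Suc by auto
  next
    case False
    show ?thesis
      using Suc.prems(1) Suc.hyps(2)[symmetric]
    proof (cases rule: comp_away_pred)
      case 1
      then show ?thesis using False Suc by auto
    next
      case (2 z)
      then show ?thesis using Suc False by fastforce
    qed
  qed
qed auto

lemma branch_eq: "branch G x y = G \<restriction> insert x (comp_away G x y)"
  by (simp add: branch_def comp_away_def)

text \<open>A shortest walk, built backwards by \<open>comp_away_pred\<close>, never leaves the
  branch.\<close>

lemma branch_walk:
  assumes "w \<in> comp_away G x y"
  shows "(x, w) \<in> arcs_ends (branch G x y) ^^ gdist G x w"
  using assms
proof (induction "gdist G x w" arbitrary: w)
  case 0
  then have "x \<noteq> w" "w \<in> verts G" using comp_away_subset by auto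
  then show ?case using 0 gdist_pos edge_verts(1) by force
next
  case (Suc n)
  show ?case
    using Suc.prems(1) Suc.hyps(2)[symmetric]
  proof (cases rule: comp_away_pred)
    case 1
    then show ?thesis
      using Suc.hyps(2)[symmetric] Suc.prems by (auto simp: branch_eq arcs_ends_induce_subgraph)
  next
    case (2 z)
    then have "(x, z) \<in> arcs_ends (branch G x y) ^^ n" using Suc.hyps(1)[of z] by simp
    moreover have "(z, w) \<in> arcs_ends (branch G x y)"
      using 2 Suc.prems by (auto simp: branch_eq arcs_ends_induce_subgraph)
    ultimately show ?thesis using Suc.hyps(2)[symmetric] by auto
  qed
qed

text \<open>One inequality comes from \<open>branch_walk\<close>, the other from the fact that walks
  in the branch are walks in \<open>G\<close>. Depths of branches can thus be measured in
  \<open>G\<close>.\<close>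

lemma gdist_branch:
  assumes "w \<in> insert x (comp_away G x y)"
  shows "gdist (branch G x y) x w = gdist G x w"
proof -
  interpret B: wf_digraph "branch G x y"
    unfolding branch_eq by (rule wellformed_induce_subgraph)
  have x: "x \<in> verts (branch G x y)" by (simp add: branch_eq)
  have "(x, w) \<in> arcs_ends (branch G x y) ^^ gdist G x w"
    using assms branch_walk gdist_le[OF edge_verts(1), of x 0] by auto
  moreover have "gdist G x w \<le> m" if "(x, w) \<in> arcs_ends (branch G x y) ^^ m" for m
  proof -
    have "arcs_ends (branch G x y) \<subseteq> arcs_ends G"
      by (auto simp: branch_eq arcs_ends_induce_subgraph)
    then have "(x, w) \<in> arcs_ends G ^^ m"
      using that relpow_mono_rel by blast
    then show ?thesis using gdist_le edge_verts(1) by blast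
  qed
  ultimately show ?thesis using B.gdist_eqI[OF x] by blast
qed

lemma branch_ecc_eq: "branch_ecc G x y = Max (gdist G x ` insert x (comp_away G x y))"
proof -
  have "branch_ecc G x y = Max (gdist (branch G x y) x ` insert x (comp_away G x y))"
    by (simp add: branch_ecc_def eccentricity_def branch_eq)
  also have "\<dots> = Max (gdist G x ` insert x (comp_away G x y))"
    using gdist_branch by (intro arg_cong[where f = Max] image_cong) auto
  finally show ?thesis .
qed

lemma finite_comp_away: "finite (comp_away G x y)"
  using comp_away_subset finite_subset[OF _ finite_verts] by blast

lemma gdist_le_branch_ecc: "w \<in> comp_away G x y \<Longrightarrow> gdist G x w \<le> branch_ecc G x y"
  unfolding branch_ecc_eq using finite_comp_away by (intro Max_ge) auto

lemma exists_comp_away_at_dist: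
  assumes "0 < d" "d \<le> branch_ecc G x y"
  shows "\<exists>c \<in> comp_away G x y. gdist G x c = d"
proof -
  have "branch_ecc G x y \<in> gdist G x ` insert x (comp_away G x y)"
    unfolding branch_ecc_eq using finite_comp_away by (intro Max_in) auto
  then obtain w where w: "branch_ecc G x y = gdist G x w" "w \<in> insert x (comp_away G x y)"
    by (rule imageE)
  \<comment> \<open>\<open>x\<close> has distance \<open>0\<close>, so it cannot attain a maximum
    that is at least \<open>d > 0\<close>.\<close>
  moreover have "gdist G x x = 0" using gdist_le[OF edge_verts(1), of x 0] by simp
  ultimately have "w \<in> comp_away G x y" using assms by auto
  then show ?thesis using comp_away_dist_downward assms w(1) by simp
qed

text \<open>\<open>x\<close> is the only way out of the component, so the walk can be cut at its
  first visit to \<open>x\<close>.\<close>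

lemma walk_leaving_comp_away:
  assumes "v \<in> comp_away G x y" "s \<notin> comp_away G x y" "(v, s) \<in> arcs_ends G ^^ n"
  shows "\<exists>i j. n = i + j \<and> (v, x) \<in> arcs_ends G ^^ i \<and> (x, s) \<in> arcs_ends G ^^ j"
  using assms
proof (induction n arbitrary: v)
  case (Suc n)
  then obtain w where w: "(v, w) \<in> arcs_ends G" "(w, s) \<in> arcs_ends G ^^ n"
    by (metis relpow_Suc_D2)
  show ?case
  proof (cases "w = x")
    case True
    then show ?thesis using w by (intro exI[of _ 1] exI[of _ n]) auto
  next
    case False
    then obtain i j where "n = i + j" "(w, x) \<in> arcs_ends G ^^ i" "(x, s) \<in> arcs_ends G ^^ j"
      using Suc.IH[OF comp_away_step[OF Suc.prems(1) w(1) False] Suc.prems(2) w(2)] by blast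
    then show ?thesis using w(1)
      by (intro exI[of _ "Suc i"] exI[of _ j]) (auto intro: relpow_Suc_I2 simp del: relpow.simps)
  qed
qed auto

text \<open>Cutting walks at \<open>x\<close> bounds the distance from below, joining shortest walks
  at \<open>x\<close> from above. Hence \<open>v\<close> influences its distances to outside
  vertices only through \<open>gdist G x v\<close>.\<close>

lemma gdist_through:
  assumes "v \<in> comp_away G x y" "s \<in> verts G" "s \<notin> comp_away G x y"
  shows "gdist G v s = gdist G x v + gdist G x s"
proof -
  have v: "v \<in> verts G" using assms(1) comp_away_subset by auto
  have "(v, s) \<in> arcs_ends G ^^ (gdist G v x + gdist G x s)"
    using gdist_walk v edge_verts(1) assms(2) by (auto simp: relpow_add)
  moreover have "gdist G v x + gdist G x s \<le> m" if "(v, s) \<in> arcs_ends G ^^ m" for m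
    using walk_leaving_comp_away[OF assms(1,3) that] gdist_le v edge_verts(1)
    by (auto intro: add_mono)
  ultimately show ?thesis using gdist_eqI[OF v] gdist_commute v edge_verts(1) by auto
qed

end

section \<open>Existence of the metric antidimension\<close>

lemma antiresolving_cond_le_card:
  assumes "us \<noteq> []" "set us \<subset> verts G" "antiresolving_cond G us k"
  shows "k \<le> card (verts G)"
proof -
  obtain v where v: "v \<in> verts G - set us" using assms(2) by auto
  then obtain W where W: "W \<subseteq> verts G - set us - {v}" "k - 1 \<le> card W"
    using bspec[OF assms(3)[unfolded antiresolving_cond_def] v] by blast
  \<comment> \<open>\<open>W\<close> omits \<open>v\<close>, and this strictness makes up for the
    \<open>1\<close> in \<open>k - 1\<close>.\<close>
  have "card W < card (verts G)"
    using W(1) v by (intro psubset_card_mono) auto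
  with W(2) show ?thesis by simp
qed

lemma exists_k_antiresolving:
  assumes "distinct us" "us \<noteq> []" "set us \<subset> verts G" "antiresolving_cond G us k"
  shows "\<exists>m \<ge> k. k_antiresolving G m us"
proof -
  let ?P = "\<lambda>j. 0 < j \<and> antiresolving_cond G us j"
  have bdd: "\<forall>j. ?P j \<longrightarrow> j \<le> card (verts G)"
    using antiresolving_cond_le_card[OF assms(2,3)] by blast
  \<comment> \<open>For \<open>j = 1\<close> the empty \<open>W\<close> suffices, since
    \<open>j - 1 = 0\<close>.\<close>
  have one: "?P 1" by (auto simp: antiresolving_cond_def)
  obtain m where m: "?P m" "\<forall>j. ?P j \<longrightarrow> j \<le> m"
    using Nat.ex_has_greatest_nat[of ?P 1, OF one bdd] by blast
  then have "k_antiresolving G m us" unfolding k_antiresolving_def using assms(1-3) by blast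
  moreover have "k \<le> m" using m(2) assms(4) by (cases "k = 0") simp_all
  ultimately show ?thesis by blast
qed

text \<open>Maximality is handled here once: a lower bound for \<open>k\<close> then only needs a
  list satisfying \<open>antiresolving_cond\<close>, not a proof that its parameter is the greatest
  one.\<close>

lemma exists_metric_antidimension:
  assumes "2 \<le> card (verts G)"
  obtains k where "k_metric_antidimensional G k"
    and "\<And>us j. distinct us \<Longrightarrow> us \<noteq> [] \<Longrightarrow> set us \<subset> verts G \<Longrightarrow> antiresolving_cond G us j \<Longrightarrow> j \<le> k"
proof -
  let ?P = "\<lambda>j. \<exists>us. k_antiresolving G j us"
  have "verts G \<noteq> {}" using assms by auto
  then obtain u where u: "u \<in> verts G" by blast
  \<comment> \<open>A second vertex makes a singleton proper, and the singleton supplies a starting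
    value for the maximum.\<close>
  have "verts G \<noteq> {u}" using assms by auto
  then have "set [u] \<subset> verts G" using u by auto
  moreover have "distinct [u]" "[u] \<noteq> []" by auto
  moreover have "antiresolving_cond G [u] 1" by (auto simp: antiresolving_cond_def)
  ultimately obtain k0 where k0: "?P k0"
    using exists_k_antiresolving[of "[u]" 1] by blast
  have bdd: "\<forall>j. ?P j \<longrightarrow> j \<le> card (verts G)"
  proof (intro allI impI)
    fix j assume "?P j"
    then obtain us where "k_antiresolving G j us" by blast
    then show "j \<le> card (verts G)"
      by (intro antiresolving_cond_le_card[of us]) (simp_all add: k_antiresolving_def)
  qed
  obtain k where k: "?P k" "\<forall>j. ?P j \<longrightarrow> j \<le> k"
    using Nat.ex_has_greatest_nat[of ?P k0, OF k0 bdd] by blast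
  have "graph G" by unfold_locales
  then have "k_metric_antidimensional G k"
    using k conn by (auto simp: k_metric_antidimensional_def)
  moreover have "j \<le> k"
    if us: "distinct us" "us \<noteq> []" "set us \<subset> verts G" "antiresolving_cond G us j" for us j
  proof -
    obtain m where "j \<le> m" "k_antiresolving G m us" using exists_k_antiresolving[OF us] by blast
    moreover from this have "m \<le> k" using k(2) by blast
    ultimately show ?thesis by simp
  qed
  ultimately show thesis by (rule that)
qed

section \<open>Distance layers around a single vertex\<close>

lemma phi_vertex_antiresolving:
  assumes "u \<in> verts G"
  shows "antiresolving_cond G [u] (phi_vertex G u)"
  unfolding antiresolving_cond_def
proof
  fix v assume v: "v \<in> verts G - set [u]"
  define i where "i = gdist G v u"
  \<comment> \<open>\<open>v\<close> differs from \<open>u\<close>, which rules out index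
    \<open>0\<close>, so the layer of \<open>v\<close> is among those minimised in
    \<open>phi_vertex\<close>.\<close>
  have i: "i \<in> {1..eccentricity G u}"
    using v assms gdist_pos[of v u] gdist_le_eccentricity[of v u] gdist_commute[of v u]
    by (auto simp: i_def)
  have fin: "finite (dist_layer G i u)" by (simp add: dist_layer_def)
  have "gdist G u u = 0" using gdist_le[OF assms, of u 0] by simp
  then have sub: "dist_layer G i u - {v} \<subseteq> verts G - set [u] - {v}"
    using i by (auto simp: dist_layer_def)
  have "phi_vertex G u \<le> card (dist_layer G i u)"
    unfolding phi_vertex_def using i by (intro Min_le) auto
  moreover have "v \<in> dist_layer G i u" using v by (auto simp: dist_layer_def i_def)
  ultimately have "phi_vertex G u - 1 \<le> card (dist_layer G i u - {v})" using fin by simp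
  moreover have "\<forall>w \<in> dist_layer G i u - {v}. metric_rep G [u] w = metric_rep G [u] v"
    by (auto simp: metric_rep_def dist_layer_def i_def)
  ultimately show "\<exists>W \<subseteq> verts G - set [u] - {v}. phi_vertex G u - 1 \<le> card W \<and>
      (\<forall>w\<in>W. metric_rep G [u] w = metric_rep G [u] v)"
    using sub by blast
qed

end

section \<open>Equivalent branches in trees\<close>

locale undirected_tree_graph = connected_graph +
  assumes acyclic: "\<not> (\<exists>c. cycle c \<and> 3 \<le> length c)"
begin

text \<open>A common vertex would yield a path from \<open>y1\<close> to \<open>y2\<close> avoiding
  \<open>x\<close>, which the two edges at \<open>x\<close> close to a forbidden cycle.\<close>

lemma comp_away_disjoint:
  assumes "(x, y1) \<in> arcs_ends G" "(x, y2) \<in> arcs_ends G" "y1 \<noteq> y2"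
  shows "comp_away G x y1 \<inter> comp_away G x y2 = {}"
proof (rule ccontr)
  interpret D: wf_digraph "del_vert x" by (rule wf_digraph_del_vert)
  have sym: "symmetric (del_vert x)"
    using graph_symmetric by (auto simp: symmetric_def sym_def arcs_ends_del_vert)
  assume "\<not> ?thesis"
  then obtain w where "y1 \<rightarrow>\<^sup>*\<^bsub>del_vert x\<^esub> w" "y2 \<rightarrow>\<^sup>*\<^bsub>del_vert x\<^esub> w"
    by (auto simp: comp_away_def)
  then have "y1 \<rightarrow>\<^sup>*\<^bsub>del_vert x\<^esub> y2"
    using symmetric_reachable[OF sym] D.reachable_trans by blast
  then obtain p where p: "D.apath y1 p y2" using D.reachable_apath by blast
  \<comment> \<open>Deleting a vertex keeps the maps \<open>tail\<close> and \<open>head\<close>, so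
    the vertex lists of walks agree in both graphs.\<close>
  have compat: "compatible G (del_vert x)"
    by (simp add: compatible_def del_vert_simps)
  have av: "D.awalk_verts = awalk_verts"
    using compatible_awalk_verts[OF compat] by simp
  have cs: "D.cas = cas" using compatible_cas[OF compat] by simp
  have aw: "D.awalk y1 p y2" using p by (simp add: D.apath_def)
  then have pG: "awalk y1 p y2"
    by (auto simp: D.awalk_def awalk_def cs del_vert_simps)
  have dist: "distinct (awalk_verts y1 p)" using p by (simp add: D.apath_def av)
  have nx: "x \<notin> set (awalk_verts y1 p)"
    using D.awalkE[OF aw] av by (auto simp: del_vert_simps)
  have ne: "p \<noteq> []" using aw assms(3) by (auto simp: D.awalk_Nil_iff)
  obtain a where a: "a \<in> arcs G" "tail G a = x" "head G a = y1" using assms(1) by auto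
  obtain b where b: "b \<in> arcs G" "tail G b = y2" "head G b = x"
    using graph_symmetric[OF assms(2)] by auto
  have "awalk y2 [b] x" using b by (auto simp: awalk_simps)
  then have "awalk y1 (p @ [b]) x" using pG by (rule awalk_appendI[rotated])
  then have c: "awalk x (a # p @ [b]) x" unfolding awalk_Cons_iff using a by blast
  have "awlast y1 p = y2" using pG by (rule awalkE)
  then have "head G (last p) = y2" using ne by (simp add: awalk_verts_conv)
  then have "awalk_verts y1 (p @ [b]) = awalk_verts y1 p @ [x]"
    using ne b by (simp add: awalk_verts_conv)
  \<comment> \<open>\<open>cycle\<close> drops the first vertex from the distinctness test, so
    \<open>x\<close> counts only at the end.\<close>
  then have "distinct (tl (awalk_verts x (a # p @ [b])))"
    using dist nx a by simp
  then have "cycle (a # p @ [b])" using c unfolding cycle_def by blast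
  moreover have "3 \<le> length (a # p @ [b])" using ne by (cases p) auto
  ultimately show False using acyclic by blast
qed

lemma equivalent_branches_antiresolving:
  assumes Y: "Y \<subseteq> neighbours G x" "pairwise (xi_equiv G x) Y" "Y \<noteq> {}"
  obtains us where "distinct us" "us \<noteq> []" "set us \<subset> verts G" "antiresolving_cond G us (card Y)"
proof -
  have adj: "(x, y) \<in> arcs_ends G" if "y \<in> Y" for y using that Y(1) by (auto simp: neighbours_def)
  obtain y' where y': "y' \<in> Y" using Y(3) by auto
  define B where "B = (\<Union>y\<in>Y. comp_away G x y)"
  have BG: "B \<subseteq> verts G - {x}" using comp_away_subset adj unfolding B_def by blast
  obtain us where us: "set us = verts G - B" "distinct us"
    using finite_distinct_list[of "verts G - B"] by auto
  have "x \<in> set us" using us edge_verts(1)[OF adj[OF y']] BG by auto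
  then have ne: "us \<noteq> []" by auto
  \<comment> \<open>This is where \<open>Y\<close> must be nonempty: with no branch removed,
    \<open>us\<close> would exhaust \<open>verts G\<close>.\<close>
  have "y' \<in> B" using comp_away_self[OF adj[OF y']] y' by (auto simp: B_def)
  then have proper: "set us \<subset> verts G" using us BG by auto
  have compl: "verts G - set us = B" using us BG by auto
  have finY: "finite Y"
    using Y(1) adj_in_verts(2) by (intro finite_subset[OF _ finite_verts]) (auto simp: neighbours_def)
  \<comment> \<open>No \<open>s\<close> in \<open>us\<close> lies in any of the chosen components,
    so \<open>gdist_through\<close> applies to every entry.\<close>
  have rep: "metric_rep G us w = map (\<lambda>s. gdist G x w + gdist G x s) us" if w: "w \<in> B" for w
  proof -
    obtain y where "y \<in> Y" "w \<in> comp_away G x y" using w by (auto simp: B_def)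
    then show ?thesis
      using us adj unfolding metric_rep_def by (auto simp: B_def intro!: gdist_through)
  qed
  have "antiresolving_cond G us (card Y)"
    unfolding antiresolving_cond_def compl
  proof
    fix v assume v: "v \<in> B"
    then obtain y0 where y0: "y0 \<in> Y" "v \<in> comp_away G x y0" by (auto simp: B_def)
    define d where "d = gdist G x v"
    have "0 < d"
      using gdist_pos[of x v] edge_verts(1)[OF adj[OF y0(1)]] v BG by (auto simp: d_def)
    \<comment> \<open>Equal depths let the level \<open>d\<close> of \<open>v\<close> be reached in
      every chosen branch.\<close>
    moreover have "d \<le> branch_ecc G x y" if "y \<in> Y" for y
    proof -
      have "branch_ecc G x y = branch_ecc G x y0"
        using Y(2) that y0(1) by (auto simp: pairwise_def xi_equiv_def)
      then show ?thesis
        using gdist_le_branch_ecc[OF adj[OF y0(1)] y0(2)] by (simp add: d_def)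
    qed
    ultimately have "\<forall>y\<in>Y. \<exists>c. c \<in> comp_away G x y \<and> gdist G x c = d"
      using exists_comp_away_at_dist[OF adj] by (meson bexE)
    then obtain f where f: "\<And>y. y \<in> Y \<Longrightarrow> f y \<in> comp_away G x y"
        "\<And>y. y \<in> Y \<Longrightarrow> gdist G x (f y) = d"
      by metis
    have inj: "inj_on f Y"
    proof (rule inj_onI, rule ccontr)
      fix y z assume "y \<in> Y" "z \<in> Y" "f y = f z" "y \<noteq> z"
      then show False using f(1)[of y] f(1)[of z] comp_away_disjoint[OF adj adj] by force
    qed
    \<comment> \<open>One vertex at level \<open>d\<close> is taken from each chosen branch except
      that of \<open>v\<close>; these are the required \<open>card Y - 1\<close> companions of
      \<open>v\<close>.\<close>
    let ?W = "f ` (Y - {y0})"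
    have "v \<noteq> f y" if "y \<in> Y - {y0}" for y
      using that y0 f(1)[of y] comp_away_disjoint[of x y y0] adj by auto
    then have "?W \<subseteq> B - {v}" using f(1) by (auto simp: B_def)
    moreover have "card Y - 1 \<le> card ?W"
      using inj y0 finY by (subst card_image) (auto intro: inj_on_subset)
    moreover have "\<forall>w\<in>?W. metric_rep G us w = metric_rep G us v"
    proof
      fix w assume "w \<in> ?W"
      then have "w \<in> B" "gdist G x w = d" using f by (auto simp: B_def)
      then show "metric_rep G us w = metric_rep G us v" using rep v by (simp add: d_def)
    qed
    ultimately show "\<exists>W \<subseteq> B - {v}. card Y - 1 \<le> card W \<and>
        (\<forall>w\<in>W. metric_rep G us w = metric_rep G us v)" by blast
  qed
  with us(2) ne proper show thesis by (rule that)
qed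

text \<open>The default value \<open>0\<close> is itself the size of an admissible set, the empty
  one, so both cases of \<open>xi_vertex\<close> have a witness.\<close>

lemma xi_vertex_witness:
  obtains Y where "Y \<subseteq> neighbours G x" "pairwise (xi_equiv G x) Y" "xi_vertex G x = card Y"
proof -
  let ?C = "{card Y | Y. Y \<subseteq> neighbours G x \<and> pairwise (xi_equiv G x) Y}"
  have "finite (neighbours G x)"
    using adj_in_verts(2) by (intro finite_subset[OF _ finite_verts]) (auto simp: neighbours_def)
  then have "finite ?C" by simp
  moreover have zero: "0 \<in> ?C" by (auto intro!: exI[of _ "{}"])
  ultimately have "Max ?C \<in> ?C" by (intro Max_in) blast+
  with zero have "xi_vertex G x \<in> ?C"
    unfolding xi_vertex_def by (simp only: simp_thms split: if_split)
  then show thesis using that by blast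
qed

end

theorem theorem15:
  fixes G :: "('a,'b) pre_digraph"
  assumes "undirected_tree G" and "2 \<le> card (verts G)"
  shows "\<exists>k. k_metric_antidimensional G k \<and> max (phi G) (xi G) \<le> k"
proof -
  interpret graph G using assms(1) by (simp add: undirected_tree_def)
  interpret undirected_tree_graph G
    using assms(1) by unfold_locales (auto simp: undirected_tree_def)
  obtain k where k: "k_metric_antidimensional G k"
    and bound: "\<And>us j. distinct us \<Longrightarrow> us \<noteq> [] \<Longrightarrow> set us \<subset> verts G \<Longrightarrow> antiresolving_cond G us j \<Longrightarrow> j \<le> k"
    using exists_metric_antidimension[OF assms(2)] by blast
  have "verts G \<noteq> {}" using assms(2) by auto
  then have "phi G \<in> phi_vertex G ` verts G" unfolding phi_def by (intro Max_in) auto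
  then obtain u where u: "u \<in> verts G" "phi G = phi_vertex G u" by auto
  have "verts G \<noteq> {u}" using assms(2) by auto
  then have "phi G \<le> k"
    using u bound[of "[u]"] phi_vertex_antiresolving[OF u(1)] by auto
  moreover have "xi G \<le> k"
  proof (cases "\<exists>x \<in> verts G. 2 \<le> out_degree G x")
    case True
    let ?X = "{xi_vertex G x | x. x \<in> verts G \<and> 2 \<le> out_degree G x}"
    have "Max ?X \<in> ?X" using True by (intro Max_in) auto
    moreover have "xi G = Max ?X" using True by (simp only: xi_def if_True)
    ultimately obtain x where "xi G = xi_vertex G x" by auto
    then obtain Y where Y: "Y \<subseteq> neighbours G x" "pairwise (xi_equiv G x) Y" "xi G = card Y"
      using xi_vertex_witness by metis
    show ?thesis
    \<comment> \<open>For empty \<open>Y\<close> the claim is \<open>0 \<le> k\<close>; an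
      antiresolving set is built only from a nonempty \<open>Y\<close>.\<close>
    proof (cases "Y = {}")
      case False
      then show ?thesis using equivalent_branches_antiresolving[OF Y(1,2)] bound Y(3) by metis
    qed (use Y in simp)
  qed (simp add: xi_def)
  ultimately show ?thesis using k by auto
qed

end
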